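(* Let $\pi$ be a set of primes and let $(B,+,\circ)$ be a finite soluble skew brace such that $(B,\circ)$ is abelian. Then the Hall $\pi$-sub-skew braces of $B$ coincide with the Hall $\pi$-subgroups of $(B,\circ)$; that is, a subset of $B$ is a Hall $\pi$-sub-skew brace of $B$ if and only if it is a Hall $\pi$-subgroup of $(B,\circ)$.
   Context: A skew (left) brace is a triple $(B,+,\circ)$ where $(B,+)$ and $(B,\circ)$ are (not necessarily abelian) groups with $a\circ(b+c)=a\circ b-a+a\circ c$ for all $a,b,c\in B$. Put $\lambda_a(b)=-a+a\circ b$. A sub-skew brace of $B$ is a subset that is a subgroup of both $(B,+)$ and $(B,\circ)$. An ideal of $B$ is a subset $I$ that is a normal subgroup of $(B,+)$, a normal subgroup of $(B,\circ)$, and satisfies $\lambda_a(I)\subseteq I$ for all $a\in B$; then $B/I$ is a skew brace with the induced operations. A skew brace is trivial of abelian type if its two operations coincide and its additive group is abelian. $B$ is soluble if there is a finite chain $\{0\}=I_0\leq I_1\leq\ldots\leq I_n=B$ of ideals of $B$ such that each $I_{j+1}/I_j$ is a trivial skew brace of abelian type. A $\pi$-number is a positive integer all of whose prime divisors lie in $\pi$. A Hall $\pi$-sub-skew brace of a finite skew brace $B$ is a sub-skew brace whose order is the largest $\pi$-number dividing $|B|$. *)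

theory Defs
  imports "HOL-Computational_Algebra.Primes" "HOL-Algebra.QuotRing"
begin

text \<open>
  A skew brace \<open>(B,+,\<circ>)\<close> is carried by a record of type \<open>ring\<close>, used only as a signature for two
  operations on one carrier: \<open>\<oplus>\<close> is \<open>+\<close> and \<open>\<otimes>\<close> is \<open>\<circ>\<close>. The group \<open>(B,+)\<close> is \<open>add_monoid B\<close>,
  and \<open>(B,\<circ>)\<close> is \<open>B\<close> itself, regarded as a monoid record. The addition need not be commutative.
\<close>

locale skew_brace =
  fixes B :: "('a, 'b) ring_scheme" (structure)
  assumes add_group: "group (add_monoid B)"
    and circ_group: "group B"
    and brace: "\<lbrakk>a \<in> carrier B; b \<in> carrier B; c \<in> carrier B\<rbrakk>
      \<Longrightarrow> a \<otimes> (b \<oplus> c) = (a \<otimes> b) \<ominus> a \<oplus> (a \<otimes> c)"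

definition brace_lambda :: "('a, 'b) ring_scheme \<Rightarrow> 'a \<Rightarrow> 'a \<Rightarrow> 'a"
  where "brace_lambda B a b = (\<ominus>\<^bsub>B\<^esub> a) \<oplus>\<^bsub>B\<^esub> (a \<otimes>\<^bsub>B\<^esub> b)"

definition sub_skew_brace :: "'a set \<Rightarrow> ('a, 'b) ring_scheme \<Rightarrow> bool"
  where "sub_skew_brace H B \<longleftrightarrow> subgroup H (add_monoid B) \<and> subgroup H B"

definition brace_ideal :: "'a set \<Rightarrow> ('a, 'b) ring_scheme \<Rightarrow> bool"
  where "brace_ideal I B \<longleftrightarrow>
    I \<lhd> add_monoid B \<and> I \<lhd> B \<and> (\<forall>a\<in>carrier B. brace_lambda B a ` I \<subseteq> I)"

locale trivial_abelian_skew_brace = skew_brace +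
  assumes ops_coincide: "\<lbrakk>a \<in> carrier B; b \<in> carrier B\<rbrakk> \<Longrightarrow> a \<otimes> b = a \<oplus> b"
    and add_comm_group: "comm_group (add_monoid B)"

text \<open>
  For an ideal \<open>I\<close> of a skew brace, the library's \<open>B Quot I\<close> is the quotient skew brace: its elements
  are the additive cosets \<open>I + a\<close>, with \<open>(I + a) + (I + b) = I + (a + b)\<close> and
  \<open>(I + a) \<circ> (I + b) = I + (a \<circ> b)\<close>. The lemmas below confirm this. In \<open>soluble_skew_brace\<close> it is
  applied to the sub-skew brace \<open>I (Suc j)\<close>, obtained by restricting the carrier.
\<close>

definition soluble_skew_brace :: "('a, 'b) ring_scheme \<Rightarrow> bool"
  where "soluble_skew_brace B \<longleftrightarrow> skew_brace B \<and>
    (\<exists>(n::nat) (I :: nat \<Rightarrow> 'a set).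
      I 0 = {\<zero>\<^bsub>B\<^esub>} \<and> I n = carrier B \<and>
      (\<forall>j\<le>n. brace_ideal (I j) B) \<and>
      (\<forall>j<n. I j \<subseteq> I (Suc j) \<and>
        trivial_abelian_skew_brace ((B\<lparr>carrier := I (Suc j)\<rparr>) Quot I j)))"

definition pi_number :: "nat set \<Rightarrow> nat \<Rightarrow> bool"
  where "pi_number \<pi> n \<longleftrightarrow> n > 0 \<and> (\<forall>p. prime p \<longrightarrow> p dvd n \<longrightarrow> p \<in> \<pi>)"

definition largest_pi_divisor :: "nat set \<Rightarrow> nat \<Rightarrow> nat"
  where "largest_pi_divisor \<pi> n = Max {d. d dvd n \<and> pi_number \<pi> d}"

definition hall_subgroup :: "nat set \<Rightarrow> 'a set \<Rightarrow> ('a, 'b) monoid_scheme \<Rightarrow> bool"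
  where "hall_subgroup \<pi> H G \<longleftrightarrow> subgroup H G \<and> card H = largest_pi_divisor \<pi> (order G)"

definition hall_sub_skew_brace :: "nat set \<Rightarrow> 'a set \<Rightarrow> ('a, 'b) ring_scheme \<Rightarrow> bool"
  where "hall_sub_skew_brace \<pi> H B \<longleftrightarrow>
    sub_skew_brace H B \<and> card H = largest_pi_divisor \<pi> (order B)"

context skew_brace
begin

interpretation A: group "add_monoid B"
  rewrites "carrier (add_monoid B) = carrier B" and "mult (add_monoid B) = add B"
    and "one (add_monoid B) = zero B" and "m_inv (add_monoid B) = a_inv B"
  by (rule add_group) (simp_all add: a_inv_def)

interpretation M: group B by (rule circ_group)

lemma one_eq_zero: "\<one> = \<zero>"
proof -
  have "\<one> \<otimes> (\<zero> \<oplus> \<zero>) = \<one> \<otimes> \<zero> \<ominus> \<one> \<oplus> \<one> \<otimes> \<zero>"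
    by (rule brace) auto
  then have "\<zero> = \<ominus> \<one>" by (simp add: a_minus_def)
  then have "\<ominus> \<zero> = \<ominus> (\<ominus> \<one>)" by (rule arg_cong)
  then show ?thesis using A.inv_inv [OF M.one_closed] A.inv_one by simp
qed

lemma circ_eq: "\<lbrakk>a \<in> carrier B; b \<in> carrier B\<rbrakk> \<Longrightarrow> a \<otimes> b = a \<oplus> brace_lambda B a b"
  unfolding brace_lambda_def by (simp add: A.m_assoc [symmetric])

lemma lambda_closed: "\<lbrakk>a \<in> carrier B; b \<in> carrier B\<rbrakk> \<Longrightarrow> brace_lambda B a b \<in> carrier B"
  unfolding brace_lambda_def by simp

lemma lambda_add:
  "\<lbrakk>a \<in> carrier B; b \<in> carrier B; c \<in> carrier B\<rbrakk>
    \<Longrightarrow> brace_lambda B a (b \<oplus> c) = brace_lambda B a b \<oplus> brace_lambda B a c"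
  unfolding brace_lambda_def by (simp add: brace a_minus_def A.m_assoc)

lemma lambda_zero: "a \<in> carrier B \<Longrightarrow> brace_lambda B a \<zero> = \<zero>"
  using M.r_one [of a] A.l_inv [of a] by (simp add: brace_lambda_def flip: one_eq_zero)

lemma lambda_inv:
  assumes "a \<in> carrier B" "b \<in> carrier B"
  shows "brace_lambda B a (\<ominus> b) = \<ominus> brace_lambda B a b"
proof -
  have "brace_lambda B a (\<ominus> b) \<oplus> brace_lambda B a b = \<zero>"
    using assms lambda_add [of a "\<ominus> b" b] lambda_zero by simp
  then show ?thesis
    using A.inv_equality [of "brace_lambda B a (\<ominus> b)" "brace_lambda B a b"] assms lambda_closed
    by simp
qed

lemma lambda_circ:
  assumes "a \<in> carrier B" "b \<in> carrier B" "c \<in> carrier B"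
  shows "brace_lambda B (a \<otimes> b) c = brace_lambda B a (brace_lambda B b c)"
proof -
  have "brace_lambda B a (brace_lambda B b c)
      = brace_lambda B a (\<ominus> b) \<oplus> brace_lambda B a (b \<otimes> c)"
    using assms lambda_add by (simp add: brace_lambda_def [of B b])
  also have "\<dots> = \<ominus> (a \<oplus> brace_lambda B a b) \<oplus> a \<otimes> (b \<otimes> c)"
    using assms lambda_closed
    by (simp add: lambda_inv A.inv_mult_group A.m_assoc brace_lambda_def [of B a "b \<otimes> c"])
  also have "a \<oplus> brace_lambda B a b = a \<otimes> b"
    using assms circ_eq by simp
  finally show ?thesis
    using assms by (simp add: brace_lambda_def [of B "a \<otimes> b"] M.m_assoc)
qed

lemma lambda_one: "c \<in> carrier B \<Longrightarrow> brace_lambda B \<one> c = c"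
  using M.l_one [of c] A.l_one [of c] A.inv_one by (simp only: brace_lambda_def one_eq_zero)

lemma ideal_lambda_inverse:
  assumes "brace_ideal I B" "a \<in> carrier B" "i \<in> I"
  shows "\<exists>k\<in>I. i = brace_lambda B a k"
proof
  have i: "i \<in> carrier B"
    using assms normal_imp_subgroup subgroup.mem_carrier unfolding brace_ideal_def by metis
  show "brace_lambda B (inv a) i \<in> I"
    using assms M.inv_closed unfolding brace_ideal_def by blast
  show "i = brace_lambda B a (brace_lambda B (inv a) i)"
    using assms i lambda_circ [of a "inv a" i] lambda_one by simp
qed

lemma ideal_cosets_agree:
  assumes I: "brace_ideal I B" and a: "a \<in> carrier B"
  shows "I +> a = I #> a"
proof -
  have N: "I \<lhd> add_monoid B" and M: "I \<lhd> B"
    using I by (auto simp: brace_ideal_def)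
  have sub: "i \<in> carrier B" if "i \<in> I" for i
    using M that normal_imp_subgroup subgroup.mem_carrier by metis
  have "I +> a = (\<Union>i\<in>I. {a \<oplus> i})"
    using normal.coset_eq [OF N] a by (simp add: a_r_coset_def l_coset_def)
  also have "\<dots> = (\<Union>i\<in>I. {a \<otimes> i})"
  proof (intro equalityI subsetI)
    fix x assume "x \<in> (\<Union>i\<in>I. {a \<oplus> i})"
    then obtain i where "i \<in> I" "x = a \<oplus> i" by auto
    then obtain k where "k \<in> I" "x = a \<oplus> brace_lambda B a k"
      using ideal_lambda_inverse [OF I a] by auto
    then show "x \<in> (\<Union>i\<in>I. {a \<otimes> i})"
      using circ_eq [OF a] sub by auto
  next
    fix x assume "x \<in> (\<Union>i\<in>I. {a \<otimes> i})"
    then obtain i where "i \<in> I" "x = a \<otimes> i" by auto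
    moreover have "brace_lambda B a i \<in> I"
      using I a \<open>i \<in> I\<close> by (auto simp: brace_ideal_def)
    ultimately show "x \<in> (\<Union>i\<in>I. {a \<oplus> i})"
      using circ_eq [OF a] sub by auto
  qed
  also have "\<dots> = I #> a"
    using normal.coset_eq [OF M] a by (simp add: l_coset_def)
  finally show ?thesis .
qed

lemma carrier_quot: "carrier (B Quot I) = (\<lambda>a. I +> a) ` carrier B"
  by (auto simp: FactRing_def A_RCOSETS_def RCOSETS_def a_r_coset_def)

lemma quot_add:
  assumes "brace_ideal I B" "a \<in> carrier B" "b \<in> carrier B"
  shows "(I +> a) \<oplus>\<^bsub>B Quot I\<^esub> (I +> b) = I +> (a \<oplus> b)"
  using assms normal.rcos_sum [of I "add_monoid B"]
  by (simp add: FactRing_def brace_ideal_def a_r_coset_def set_add_def)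

lemma quot_circ:
  assumes I: "brace_ideal I B" and ab: "a \<in> carrier B" "b \<in> carrier B"
  shows "(I +> a) \<otimes>\<^bsub>B Quot I\<^esub> (I +> b) = I +> (a \<otimes> b)"
proof -
  have N: "I \<lhd> add_monoid B" and M: "I \<lhd> B"
    using I by (auto simp: brace_ideal_def)
  have sI: "subgroup I B" using M by (rule normal_imp_subgroup)
  have eq: "I +> (x \<otimes> y) = I +> (a \<otimes> b)" if "x \<in> I +> a" "y \<in> I +> b" for x y
  proof -
    have x: "x \<in> I #> a" and y: "y \<in> I #> b"
      using that ideal_cosets_agree [OF I] ab by auto
    then have c: "x \<in> carrier B" "y \<in> carrier B"
      using M.r_coset_subset_G [of I] sI subgroup.subset ab by blast+
    have "x \<otimes> y \<in> (I #> a) <#> (I #> b)"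
      using x y by (auto simp: set_mult_def)
    then have "x \<otimes> y \<in> I #> (a \<otimes> b)"
      using normal.rcos_sum [OF M] ab by simp
    then have "I #> (a \<otimes> b) = I #> (x \<otimes> y)"
      using M.repr_independence sI ab by simp
    then show ?thesis
      using ideal_cosets_agree [OF I] ab c by simp
  qed
  have "a \<in> I +> a" "b \<in> I +> b"
    using ideal_cosets_agree [OF I] M.rcos_self sI ab by auto
  then have "(\<Union>x\<in>I +> a. \<Union>y\<in>I +> b. I +> (x \<otimes> y)) = I +> (a \<otimes> b)"
    using eq by blast
  then show ?thesis
    by (simp add: FactRing_def rcoset_mult_def)
qed

lemma add_monoid_quot: "carrier (add_monoid (B Quot I)) = carrier (add_monoid B Mod I)"
  "mult (add_monoid (B Quot I)) = mult (add_monoid B Mod I)"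
  "one (add_monoid (B Quot I)) = one (add_monoid B Mod I)"
  by (auto simp: FactRing_def FactGroup_def A_RCOSETS_def set_add_def)

lemma skew_brace_quot:
  assumes I: "brace_ideal I B"
  shows "skew_brace (B Quot I)"
proof -
  have N: "I \<lhd> add_monoid B" and M: "I \<lhd> B"
    using I by (auto simp: brace_ideal_def)
  have "add_monoid (B Quot I) = add_monoid B Mod I"
    using add_monoid_quot by (intro monoid.equality) auto
  then have addg: "group (add_monoid (B Quot I))"
    using normal.factorgroup_is_group [OF N] by simp
  interpret Q: group "add_monoid (B Quot I)"
    rewrites "m_inv (add_monoid (B Quot I)) = a_inv (B Quot I)"
    by (rule addg) (simp add: a_inv_def)
  have one: "\<one>\<^bsub>B Quot I\<^esub> = I +> \<one>" by (simp add: FactRing_def)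
  have circg: "group (B Quot I)"
  proof (rule groupI)
    show "\<exists>y\<in>carrier (B Quot I). y \<otimes>\<^bsub>B Quot I\<^esub> x = \<one>\<^bsub>B Quot I\<^esub>"
      if "x \<in> carrier (B Quot I)" for x
    proof -
      from that obtain a where a: "a \<in> carrier B" "x = I +> a" by (auto simp: carrier_quot)
      then have "(I +> inv a) \<otimes>\<^bsub>B Quot I\<^esub> x = \<one>\<^bsub>B Quot I\<^esub>"
        using quot_circ [OF I, of "inv a" a] by (simp add: one)
      then show ?thesis using a by (auto simp: carrier_quot)
    qed
  qed (auto simp: carrier_quot one quot_circ [OF I] M.m_assoc)
  have neg: "\<ominus>\<^bsub>B Quot I\<^esub> (I +> a) = I +> (\<ominus> a)" if "a \<in> carrier B" for a
  proof -
    have "(I +> (\<ominus> a)) \<oplus>\<^bsub>B Quot I\<^esub> (I +> a) = I +> \<zero>"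
      using quot_add [OF I, of "\<ominus> a" a] that by simp
    also have "\<dots> = \<zero>\<^bsub>B Quot I\<^esub>"
      using ideal_cosets_agree [OF I M.one_closed] M.coset_mult_one [of I]
        subgroup.subset [OF normal_imp_subgroup [OF M]]
      by (simp add: FactRing_def one_eq_zero)
    finally show ?thesis
      using Q.inv_equality [of "I +> (\<ominus> a)" "I +> a"] that by (simp add: carrier_quot)
  qed
  show ?thesis
  proof (rule skew_brace.intro)
    fix x y z
    assume "x \<in> carrier (B Quot I)" "y \<in> carrier (B Quot I)" "z \<in> carrier (B Quot I)"
    then obtain a b c where "a \<in> carrier B" "b \<in> carrier B" "c \<in> carrier B"
      "x = I +> a" "y = I +> b" "z = I +> c" by (auto simp: carrier_quot)
    then show "x \<otimes>\<^bsub>B Quot I\<^esub> (y \<oplus>\<^bsub>B Quot I\<^esub> z)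
        = (x \<otimes>\<^bsub>B Quot I\<^esub> y) \<ominus>\<^bsub>B Quot I\<^esub> x \<oplus>\<^bsub>B Quot I\<^esub> (x \<otimes>\<^bsub>B Quot I\<^esub> z)"
      by (simp add: a_minus_def neg quot_add [OF I] quot_circ [OF I] brace)
  qed (rule addg, rule circg)
qed

end

end

theory Submission
  imports Defs "HOL-Algebra.Multiplicative_Group"
begin

text \<open>
  A Hall \<open>\<pi>\<close>-subgroup \<open>H\<close> of the abelian group \<open>(B,\<circ>)\<close> has order coprime to its index, so the
  claim is that a subgroup \<open>H\<close> of this kind is a subgroup of \<open>(B,+)\<close>. For every ideal \<open>I\<close> the set
  \<open>H \<circ> I\<close> is a subgroup of \<open>(B,\<circ>)\<close>. The proof walks down the chain of ideals \<open>B = I\<^sub>n \<supseteq> \<dots> \<supseteq> I\<^sub>0 = 0\<close> and shows that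
  each \<open>H \<circ> I\<^sub>j\<close> is an additive subgroup; at \<open>j = 0\<close> this is the claim. One step takes place in the
  quotient by \<open>I\<^sub>j\<close>, where \<open>A = I\<^sub>j\<^sub>+\<^sub>1 / I\<^sub>j\<close> is an ideal on which the two operations agree, and
  \<open>H \<circ> A\<close> is known to be an additive subgroup.

  Put \<open>m = \<bar>H\<bar>\<close>. Replacing \<open>A\<close> by its ideal of \<open>m\<close>-th powers leaves \<open>H \<circ> A\<close> unchanged, because the
  elements of \<open>A\<close> whose \<open>m\<close>-th power is trivial already lie in \<open>H\<close>; afterwards \<open>a \<mapsto> a\<^sup>m\<close> is a
  bijection of \<open>A\<close>. This is \<open>additive_subgroup_of_coprime_exponent\<close>.

  The heart is \<open>coprime_trivial_ideal.additive_subgroup\<close>, an averaging argument in the manner of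
  Schur and Zassenhaus for an abelian kernel. In \<open>S = H \<circ> A = A + H\<close> every element is uniquely \<open>a + h\<close>;
  call \<open>a\<close> its ideal part. A self-map \<open>f\<close> of \<open>S\<close> that is affine over \<open>A\<close>, with linear part \<open>\<alpha>\<close>, permutes
  the cosets of \<open>A\<close>, and the product over \<open>h \<in> H\<close> of the ideal parts of \<open>f h\<close> measures how far \<open>f\<close> is
  from preserving the transversal \<open>H\<close>. This defect is a cocycle, and since \<open>m\<close> is invertible on \<open>A\<close>
  one may correct it by a coboundary. Three kinds of affine maps matter: the additive
  translations by \<open>x\<close>, the automorphisms \<open>\<lambda>\<^sub>h\<close>, and their composites \<open>z \<mapsto> h \<circ> z = h + \<lambda>\<^sub>h z\<close>, whose
  defect vanishes because they permute \<open>H\<close>. Averaging over \<open>H\<close> gives an \<open>a \<in> A\<close> such that the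
  corrected defect of every \<open>\<lambda>\<^sub>h\<close> vanishes. The translations with vanishing corrected defect
  form an additive subgroup \<open>K\<close> that meets each coset of \<open>A\<close> at most once. Commutativity of \<open>\<circ>\<close> enters
  through \<open>\<lambda>\<^sub>b h = - b + h \<circ> b\<close>, which for \<open>b = -a\<close> shows \<open>\<lambda>\<^sub>b h \<in> K\<close>. Counting gives \<open>\<lambda>\<^sub>b(H) = K\<close>, and
  \<open>\<lambda>\<^sub>b\<close> is an additive automorphism, so \<open>H\<close> is an additive subgroup along with \<open>K\<close>.
\<close>

section \<open>Skew braces with commutative circle operation\<close>

locale comm_skew_brace = skew_brace +
  assumes circ_comm: "comm_group B"

sublocale comm_skew_brace \<subseteq> add: group "add_monoid B"
  rewrites "carrier (add_monoid B) = carrier B" and "mult (add_monoid B) = add B"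
    and "one (add_monoid B) = zero B" and "m_inv (add_monoid B) = a_inv B"
  by (rule add_group) (simp_all add: a_inv_def)

sublocale comm_skew_brace \<subseteq> comm_group B
  by (rule circ_comm)

context comm_skew_brace
begin

lemma ideal_carrier: "brace_ideal A B \<Longrightarrow> a \<in> A \<Longrightarrow> a \<in> carrier B"
  unfolding brace_ideal_def using normal_imp_subgroup subgroup.mem_carrier by metis

lemma add_cancel_left [simp]:
  assumes "x \<in> carrier B" "y \<in> carrier B"
  shows "\<ominus> x \<oplus> (x \<oplus> y) = y" "x \<oplus> (\<ominus> x \<oplus> y) = y"
  using assms by (simp_all flip: add.m_assoc)

lemma cancel_middle:
  assumes "x \<in> carrier B" "y \<in> carrier B" "u \<in> carrier B" "v \<in> carrier B" "w \<in> carrier B"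
  shows "(x \<otimes> inv y \<otimes> u) \<otimes> (y \<otimes> inv w \<otimes> v) = x \<otimes> inv w \<otimes> (u \<otimes> v)"
proof -
  have "(x \<otimes> inv y \<otimes> u) \<otimes> (y \<otimes> inv w \<otimes> v) = (inv y \<otimes> y) \<otimes> (x \<otimes> inv w \<otimes> (u \<otimes> v))"
    using assms by (simp only: m_ac m_closed inv_closed)
  then show ?thesis using assms by simp
qed

lemma lambda_inj:
  assumes "x \<in> carrier B" "y \<in> carrier B" "z \<in> carrier B"
    and "brace_lambda B x y = brace_lambda B x z"
  shows "y = z"
  using assms unfolding brace_lambda_def by simp

text \<open>
  The additive and the multiplicative coset of an ideal through \<open>h\<close> are the same set, so factors
  from the ideal can be moved from one operation to the other at the price of changing them.
\<close>

lemma circ_coset_is_add_coset: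
  assumes "brace_ideal A B" "h \<in> carrier B" "a \<in> A"
  shows "\<exists>a'\<in>A. h \<otimes> a = a' \<oplus> h" and "\<exists>a'\<in>A. a \<oplus> h = h \<otimes> a'"
proof -
  have eq: "A +> h = A #> h" using ideal_cosets_agree assms by blast
  have c: "a \<in> carrier B" using ideal_carrier assms by blast
  have "h \<otimes> a \<in> A #> h"
    using assms c by (auto simp: r_coset_def intro: m_comm)
  then show "\<exists>a'\<in>A. h \<otimes> a = a' \<oplus> h"
    unfolding eq[symmetric] a_r_coset_def' by auto
  have "a \<oplus> h \<in> A +> h" using assms by (auto simp: a_r_coset_def')
  then show "\<exists>a'\<in>A. a \<oplus> h = h \<otimes> a'"
    unfolding eq r_coset_def using assms ideal_carrier[OF assms(1)] m_comm by fastforce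
qed

end

section \<open>A trivial ideal of order coprime to a complement\<close>

text \<open>
  The injective power map is the form in which coprimality of \<open>card H\<close> and \<open>card A\<close> is used: it
  allows division by \<open>card H\<close> in \<open>A\<close>. Since \<open>A\<close> is trivial, \<open>\<otimes>\<close> and \<open>\<oplus>\<close> agree on it, and all
  computations inside \<open>A\<close> are written with \<open>\<otimes>\<close>, for which products over finite sets are available.
\<close>

locale coprime_trivial_ideal = comm_skew_brace +
  fixes A H S :: "'a set"
  assumes finite_carrier: "finite (carrier B)"
    and ideal: "brace_ideal A B"
    and trivial: "\<lbrakk>a \<in> A; b \<in> A\<rbrakk> \<Longrightarrow> a \<otimes> b = a \<oplus> b"
    and H_subgroup: "subgroup H B"
    and pow_inj: "inj_on (\<lambda>a. a [^] card H) A"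
  defines "S \<equiv> H <#> A"
  assumes S_subgroup: "subgroup S (add_monoid B)"
begin

sublocale H: subgroup H B by (rule H_subgroup)

lemma A_normals: "A \<lhd> add_monoid B" "A \<lhd> B"
  using ideal by (auto simp: brace_ideal_def)

sublocale A: subgroup A B
  using A_normals normal_imp_subgroup by blast

sublocale A_add: subgroup A "add_monoid B"
  rewrites "carrier (add_monoid B) = carrier B" and "mult (add_monoid B) = add B"
    and "one (add_monoid B) = zero B" and "m_inv (add_monoid B) = a_inv B"
  using A_normals normal_imp_subgroup by (blast | simp add: a_inv_def)+

sublocale S: subgroup S "add_monoid B"
  rewrites "carrier (add_monoid B) = carrier B" and "mult (add_monoid B) = add B"
    and "one (add_monoid B) = zero B" and "m_inv (add_monoid B) = a_inv B"
  using S_subgroup by (blast | simp add: a_inv_def)+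

lemma conj_closed: "x \<in> carrier B \<Longrightarrow> a \<in> A \<Longrightarrow> x \<oplus> a \<oplus> (\<ominus> x) \<in> A"
  using add.normal_inv_iff[of A] A_normals(1) by (simp add: a_inv_def[symmetric])

lemma lambda_A: "x \<in> carrier B \<Longrightarrow> a \<in> A \<Longrightarrow> brace_lambda B x a \<in> A"
  using ideal unfolding brace_ideal_def by blast

lemma neg_A: "a \<in> A \<Longrightarrow> \<ominus> a = inv a"
proof -
  assume a: "a \<in> A"
  then have "inv a \<oplus> a = \<zero>" using trivial[of "inv a" a] by (simp add: one_eq_zero)
  then show ?thesis using add.inv_equality[of "inv a" a] a by simp
qed

lemma H_Int_A: "h \<in> H \<Longrightarrow> h \<in> A \<Longrightarrow> h = \<one>"
proof -
  assume h: "h \<in> H" "h \<in> A"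
  interpret HG: group "B\<lparr>carrier := H\<rparr>" using H.subgroup_is_group is_group by blast
  have "h [^] card H = \<one>"
    using HG.pow_order_eq_1[of h] h nat_pow_consistent[of h "card H" H] by (simp add: order_def)
  then show ?thesis using inj_onD[OF pow_inj, of h \<one>] h by simp
qed

lemma S_iff: "x \<in> S \<longleftrightarrow> (\<exists>h\<in>H. \<exists>a\<in>A. x = a \<oplus> h)"
proof
  assume "x \<in> S"
  then obtain h a where *: "h \<in> H" "a \<in> A" "x = h \<otimes> a" unfolding S_def set_mult_def by auto
  then show "\<exists>h\<in>H. \<exists>a\<in>A. x = a \<oplus> h"
    using circ_coset_is_add_coset(1)[OF ideal H.mem_carrier[OF *(1)] *(2)] by auto
next
  assume "\<exists>h\<in>H. \<exists>a\<in>A. x = a \<oplus> h"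
  then obtain h a where *: "h \<in> H" "a \<in> A" "x = a \<oplus> h" by blast
  then obtain a' where "a' \<in> A" "x = h \<otimes> a'" 
    using circ_coset_is_add_coset(2)[OF ideal H.mem_carrier[OF *(1)] *(2)] by auto
  with *(1) show "x \<in> S" unfolding S_def set_mult_def by auto
qed

lemma S_addI: "a \<in> A \<Longrightarrow> h \<in> H \<Longrightarrow> a \<oplus> h \<in> S"
  using S_iff by blast

lemma H_in_S: "h \<in> H \<Longrightarrow> h \<in> S"
  using S_addI[of "\<zero>" h] by simp

lemma A_in_S: "a \<in> A \<Longrightarrow> a \<in> S"
  using S_addI[of a "\<one>"] H.one_closed by (simp add: one_eq_zero)

lemma S_circ: assumes "x \<in> S" "y \<in> S" shows "x \<otimes> y \<in> S"
proof -
  obtain h a k b where *: "h \<in> H" "a \<in> A" "k \<in> H" "b \<in> A" "x = h \<otimes> a" "y = k \<otimes> b"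
    using assms unfolding S_def set_mult_def by auto
  then have "x \<otimes> y = (h \<otimes> k) \<otimes> (a \<otimes> b)" by (simp add: m_ac)
  moreover have "h \<otimes> k \<in> H" "a \<otimes> b \<in> A" using * by auto
  ultimately show ?thesis unfolding S_def set_mult_def by auto
qed

lemma S_lambda: "x \<in> S \<Longrightarrow> y \<in> S \<Longrightarrow> brace_lambda B x y \<in> S"
  unfolding brace_lambda_def using S_circ by simp

lemma decomposition_unique:
  assumes "a \<in> A" "b \<in> A" "h \<in> H" "k \<in> H" "a \<oplus> h = b \<oplus> k"
  shows "a = b" "h = k"
proof -
  obtain c d where cd: "c \<in> A" "d \<in> A" "a \<oplus> h = h \<otimes> c" "b \<oplus> k = k \<otimes> d"
    using circ_coset_is_add_coset(2)[OF ideal] assms by (meson H.mem_carrier)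
  then have "h \<otimes> c = k \<otimes> d" using assms by simp
  then have "inv k \<otimes> h = d \<otimes> inv c" using assms cd
    by (metis (no_types, opaque_lifting) A.mem_carrier H.mem_carrier inv_closed inv_solve_left inv_solve_right m_assoc m_closed)
  moreover have "inv k \<otimes> h \<in> H" "d \<otimes> inv c \<in> A" using assms cd by auto
  ultimately have "inv k \<otimes> h = \<one>" using H_Int_A by metis
  then have "k \<otimes> (inv k \<otimes> h) = k" using assms(4) by simp
  then show hk: "h = k" using assms(3,4) by (simp add: m_assoc[symmetric])
  have "a \<oplus> k = b \<oplus> k" using assms(5) unfolding hk .
  then show "a = b" using assms(1,2,4) by simp
qed

definition ideal_part :: "'a \<Rightarrow> 'a"
  where "ideal_part x = (THE a. a \<in> A \<and> (\<exists>h\<in>H. x = a \<oplus> h))"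

definition complement_part :: "'a \<Rightarrow> 'a"
  where "complement_part x = (THE h. h \<in> H \<and> (\<exists>a\<in>A. x = a \<oplus> h))"

lemma ideal_part_eq [simp]: "a \<in> A \<Longrightarrow> h \<in> H \<Longrightarrow> ideal_part (a \<oplus> h) = a"
  unfolding ideal_part_def by (rule the_equality) (auto dest: decomposition_unique(1))

lemma complement_part_eq [simp]: "a \<in> A \<Longrightarrow> h \<in> H \<Longrightarrow> complement_part (a \<oplus> h) = h"
  unfolding complement_part_def by (rule the_equality) (auto dest: decomposition_unique(2))

lemma parts:
  assumes "x \<in> S"
  shows "ideal_part x \<in> A" "complement_part x \<in> H" "ideal_part x \<oplus> complement_part x = x"
  using assms unfolding S_iff by auto

lemma ideal_part_H: "h \<in> H \<Longrightarrow> ideal_part h = \<one>"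
  using ideal_part_eq[of \<zero> h] by (simp add: one_eq_zero)

lemma ideal_part_add: 
  assumes "a \<in> A" "x \<in> S" shows "ideal_part (a \<oplus> x) = a \<otimes> ideal_part x"
proof -
  have "a \<oplus> x = (a \<oplus> ideal_part x) \<oplus> complement_part x"
    using parts[OF assms(2)] assms by (metis A_add.mem_carrier H.mem_carrier add.m_assoc)
  moreover have "ideal_part ((a \<oplus> ideal_part x) \<oplus> complement_part x) = a \<oplus> ideal_part x"
    using parts[OF assms(2)] assms(1) by (intro ideal_part_eq) auto
  ultimately show ?thesis using parts(1)[OF assms(2)] assms(1) trivial by metis
qed

section \<open>Affine maps and their defect\<close>

text \<open>
  The maps of \<open>S\<close> that are affine over \<open>A\<close>, with linear part \<open>\<alpha>\<close>. They send cosets of \<open>A\<close> to cosets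
  of \<open>A\<close>. The translation law makes \<open>\<alpha>\<close> additive, and injectivity of \<open>f\<close> with finiteness makes it
  bijective.
\<close>

definition affine :: "('a \<Rightarrow> 'a) \<Rightarrow> ('a \<Rightarrow> 'a) \<Rightarrow> bool"
  where "affine f \<alpha> \<longleftrightarrow> f \<in> S \<rightarrow> S \<and> inj_on f S \<and> \<alpha> \<in> A \<rightarrow> A \<and>
    (\<forall>a\<in>A. \<forall>x\<in>S. f (a \<oplus> x) = \<alpha> a \<oplus> f x)"

lemma affineD:
  assumes "affine f \<alpha>"
  shows "x \<in> S \<Longrightarrow> f x \<in> S" "inj_on f S" "a \<in> A \<Longrightarrow> \<alpha> a \<in> A"
    "a \<in> A \<Longrightarrow> x \<in> S \<Longrightarrow> f (a \<oplus> x) = \<alpha> a \<oplus> f x"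
  using assms unfolding affine_def by auto

lemma affine_mult:
  assumes f: "affine f \<alpha>" and ab: "a \<in> A" "b \<in> A"
  shows "\<alpha> (a \<otimes> b) = \<alpha> a \<otimes> \<alpha> b"
proof -
  note D = affineD[OF f]
  have z: "\<zero> \<in> S" by simp
  have c: "\<alpha> a \<in> carrier B" "\<alpha> b \<in> carrier B" "\<alpha> (a \<oplus> b) \<in> carrier B" "f \<zero> \<in> carrier B"
    using D ab z by auto
  have "\<alpha> (a \<oplus> b) \<oplus> f \<zero> = f (a \<oplus> (b \<oplus> \<zero>))" using D(4)[of "a \<oplus> b" \<zero>] ab z
    by (simp add: add.m_assoc)
  also have "\<dots> = \<alpha> a \<oplus> (\<alpha> b \<oplus> f \<zero>)" using D(4)[of a "b \<oplus> \<zero>"] D(4)[of b \<zero>] ab z A_in_S[of b] by simp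
  also have "\<dots> = (\<alpha> a \<oplus> \<alpha> b) \<oplus> f \<zero>" using c by (simp add: add.m_assoc)
  finally have "\<alpha> (a \<oplus> b) = \<alpha> a \<oplus> \<alpha> b" using c by simp
  then show ?thesis using trivial D ab by simp
qed

lemma affine_pow:
  assumes f: "affine f \<alpha>" and a: "a \<in> A"
  shows "\<alpha> \<one> = \<one>" "\<alpha> (a [^] (n::nat)) = \<alpha> a [^] n" "\<alpha> (inv a) = inv (\<alpha> a)"
proof -
  note D = affineD[OF f]
  have "\<alpha> \<one> \<otimes> \<alpha> \<one> = \<alpha> \<one>" using affine_mult[OF f, of \<one> \<one>] by simp
  then show 1: "\<alpha> \<one> = \<one>" using D(3)[of \<one>] by simp
  have p: "a [^] k \<in> A" for k :: nat by (induction k) (use a in auto)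
  show "\<alpha> (a [^] (n::nat)) = \<alpha> a [^] n"
    by (induction n) (use 1 affine_mult[OF f] p a in auto)
  have "\<alpha> (inv a) \<otimes> \<alpha> a = \<one>" using affine_mult[OF f, of "inv a" a] a 1 by simp
  then show "\<alpha> (inv a) = inv (\<alpha> a)" using inv_equality[of "\<alpha> (inv a)" "\<alpha> a"] D(3) a by simp
qed

lemma affine_finprod:
  assumes f: "affine f \<alpha>" and "finite F" and "u \<in> F \<rightarrow> A"
  shows "finprod B u F \<in> A" "\<alpha> (finprod B u F) = finprod B (\<lambda>x. \<alpha> (u x)) F"
proof -
  note D = affineD[OF f]
  have "finprod B u F \<in> A \<and> \<alpha> (finprod B u F) = finprod B (\<lambda>x. \<alpha> (u x)) F"
    using assms(2,3)
  proof (induction F rule: finite_induct)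
    case empty then show ?case using affine_pow(1)[OF f, of \<one>] by simp
  next
    case (insert x F)
    then have "u \<in> F \<rightarrow> carrier B" "u x \<in> carrier B" "(\<lambda>x. \<alpha> (u x)) \<in> F \<rightarrow> carrier B" "\<alpha> (u x) \<in> carrier B"
      using D(3) by (auto simp: Pi_iff)
    with insert show ?case by (simp add: affine_mult[OF f])
  qed
  then show "finprod B u F \<in> A" "\<alpha> (finprod B u F) = finprod B (\<lambda>x. \<alpha> (u x)) F" by auto
qed

lemma finite_A: "finite A" and finite_H: "finite H" and finite_S: "finite S"
  using finite_carrier A.subset H.subset S.subset finite_subset by blast+

lemma affine_surj:
  assumes f: "affine f \<alpha>" shows "\<alpha> ` A = A"
proof -
  note D = affineD[OF f]
  have inj: "inj_on \<alpha> A"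
  proof (rule inj_onI)
    fix a b assume ab: "a \<in> A" "b \<in> A" "\<alpha> a = \<alpha> b"
    have zS: "\<zero> \<in> S" by simp
    have "f (a \<oplus> \<zero>) = f (b \<oplus> \<zero>)" unfolding D(4)[OF ab(1) zS] D(4)[OF ab(2) zS] ab(3) ..
    then have "f a = f b" using ab by simp
    then show "a = b" by (rule inj_onD[OF D(2)]) (use ab A_in_S in auto)
  qed
  have "\<alpha> ` A \<subseteq> A" using D(3) by auto
  then show ?thesis using inj by (rule endo_inj_surj[OF finite_A])
qed

text \<open>
  Two elements \<open>h\<close>, \<open>k\<close> of \<open>H\<close> with images in one coset satisfy \<open>f h = c \<oplus> f k\<close> for some \<open>c \<in> A\<close>.
  As the linear part is onto \<open>A\<close>, the right side is \<open>f (a \<oplus> k)\<close> for some \<open>a\<close>, and injectivity of \<open>f\<close>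
  puts \<open>h\<close> and \<open>k\<close> in the same coset of \<open>A\<close>.
\<close>

lemma affine_permutes_cosets:
  assumes f: "affine f \<alpha>" shows "bij_betw (\<lambda>h. complement_part (f h)) H H"
proof -
  note D = affineD[OF f]
  have inj: "inj_on (\<lambda>h. complement_part (f h)) H"
  proof (rule inj_onI)
    fix h k assume hk: "h \<in> H" "k \<in> H" "complement_part (f h) = complement_part (f k)"
    have s: "f h \<in> S" "f k \<in> S" using D(1) H_in_S hk by auto
    let ?c = "ideal_part (f h) \<oplus> \<ominus> ideal_part (f k)"
    have c: "?c \<in> A" using parts s by simp
    have "?c \<oplus> (ideal_part (f k) \<oplus> complement_part (f k)) = ideal_part (f h) \<oplus> complement_part (f h)"
      using parts(1,2)[OF s(1)] parts(1)[OF s(2)] hk(3) by (simp add: add.m_assoc)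
    then have e: "?c \<oplus> f k = f h" unfolding parts(3)[OF s(1)] parts(3)[OF s(2)] .
    obtain a where a: "a \<in> A" "\<alpha> a = ?c" using affine_surj[OF f] c by (metis imageE)
    have S: "a \<oplus> k \<in> S" "\<zero> \<oplus> h \<in> S" using S_addI[OF a(1) hk(2)] S_addI[OF _ hk(1)] by auto
    have "f (a \<oplus> k) = f h" unfolding D(4)[OF a(1) H_in_S[OF hk(2)]] a(2) by (rule e)
    then have "f (a \<oplus> k) = f (\<zero> \<oplus> h)" using hk by simp
    then have eq: "a \<oplus> k = \<zero> \<oplus> h" using S by (rule inj_onD[OF D(2)])
    show "h = k" by (rule decomposition_unique(2)[OF _ a(1) hk(1,2) eq[symmetric]]) simp
  qed
  have "(\<lambda>h. complement_part (f h)) ` H \<subseteq> H" using parts(2) D(1) H_in_S by auto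
  then have "(\<lambda>h. complement_part (f h)) ` H = H" by (rule endo_inj_surj[OF finite_H _ inj])
  with inj show ?thesis unfolding bij_betw_def by (rule conjI)
qed

text \<open>
  The difference, in the abelian group \<open>A\<close>, between the transversals \<open>f(H)\<close> and \<open>H\<close> of \<open>A\<close> in \<open>S\<close>.
\<close>

definition defect :: "('a \<Rightarrow> 'a) \<Rightarrow> 'a"
  where "defect f = finprod B (\<lambda>h. ideal_part (f h)) H"

lemma defect_closed: "affine f \<alpha> \<Longrightarrow> defect f \<in> A"
  unfolding defect_def using affine_finprod(1)[of f \<alpha> H] finite_H affineD(1) parts(1) H_in_S
  by (metis (no_types, lifting) Pi_I)

text \<open>
  The cocycle law. Write \<open>g h = c \<oplus> k\<close> with \<open>c \<in> A\<close>, \<open>k \<in> H\<close>; then \<open>f (g h) = \<alpha> c \<oplus> f k\<close>, and \<open>k\<close> runs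
  through all of \<open>H\<close> as \<open>h\<close> does.
\<close>

lemma defect_comp:
  assumes f: "affine f \<alpha>" and g: "affine g \<beta>"
  shows "defect (f \<circ> g) = \<alpha> (defect g) \<otimes> defect f"
proof -
  note D = affineD[OF f] and E = affineD[OF g]
  have s: "g h \<in> S" if "h \<in> H" for h using E H_in_S that by blast
  have r: "complement_part (g h) \<in> H" "ideal_part (g h) \<in> A" if "h \<in> H" for h using parts s that by auto
  have t: "\<alpha> (ideal_part (g h)) \<in> A" "ideal_part (f (complement_part (g h))) \<in> A" if "h \<in> H" for h
    using D H_in_S r that parts by auto
  have "ideal_part ((f \<circ> g) h) = \<alpha> (ideal_part (g h)) \<otimes> ideal_part (f (complement_part (g h)))" if "h \<in> H" for h
    using parts[OF s[OF that]] D(4)[of "ideal_part (g h)" "complement_part (g h)"] D(3) D(1) H_in_S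
      ideal_part_add by (metis comp_apply)
  then have "defect (f \<circ> g) = finprod B (\<lambda>h. \<alpha> (ideal_part (g h)) \<otimes> ideal_part (f (complement_part (g h)))) H"
    unfolding defect_def using t by (intro finprod_cong') auto
  also have "\<dots> = finprod B (\<lambda>h. \<alpha> (ideal_part (g h))) H \<otimes> finprod B (\<lambda>h. ideal_part (f (complement_part (g h)))) H"
    using t by (intro finprod_multf) auto
  also have "finprod B (\<lambda>h. \<alpha> (ideal_part (g h))) H = \<alpha> (defect g)"
    unfolding defect_def using affine_finprod(2)[OF f finite_H, of "\<lambda>h. ideal_part (g h)"] r by auto
  also have "finprod B (\<lambda>h. ideal_part (f (complement_part (g h)))) H = defect f"
  proof -
    have b: "bij_betw (\<lambda>h. complement_part (g h)) H H" using affine_permutes_cosets[OF g] .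
    have "(\<lambda>h. ideal_part (f h)) \<in> (\<lambda>h. complement_part (g h)) ` H \<rightarrow> carrier B"
      using D(1) H_in_S parts r by (auto intro!: A.mem_carrier)
    then show ?thesis
      using finprod_reindex[of "\<lambda>h. ideal_part (f h)" "\<lambda>h. complement_part (g h)" H] b
      by (simp add: bij_betw_def defect_def)
  qed
  finally show ?thesis .
qed

lemma defect_cong:
  assumes "\<And>h. h \<in> H \<Longrightarrow> f h \<in> S" "\<And>h. h \<in> H \<Longrightarrow> f h = g h"
  shows "defect f = defect g"
  unfolding defect_def using assms parts(1) by (intro finprod_cong') (auto 4 3)

lemma affine_lambda:
  assumes x: "x \<in> S"
  shows "affine (brace_lambda B x) (brace_lambda B x)"
proof -
  have xc: "x \<in> carrier B" using x by simp
  have "inj_on (brace_lambda B x) S" using lambda_inj[OF xc] by (auto intro!: inj_onI)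
  then show ?thesis unfolding affine_def using S_lambda[OF x] lambda_A[OF xc] lambda_add[OF xc] by simp
qed

lemma affine_translation:
  assumes x: "x \<in> S"
  shows "affine (\<lambda>z. x \<oplus> z) (\<lambda>a. x \<oplus> a \<oplus> \<ominus> x)"
  unfolding affine_def using x conj_closed
  by (auto intro!: inj_onI simp: add.m_assoc)

lemma pow_A: "a \<in> A \<Longrightarrow> a [^] (n::nat) \<in> A"
  by (induction n) auto

lemma pow_image: "(\<lambda>a. a [^] card H) ` A = A"
  using pow_A by (intro endo_inj_surj[OF finite_A _ pow_inj]) auto

lemma pow_eq_one: "a \<in> A \<Longrightarrow> a [^] card H = \<one> \<Longrightarrow> a = \<one>"
  using inj_onD[OF pow_inj, of a \<one>] by simp

lemma H_translate: "h \<in> H \<Longrightarrow> bij_betw (\<lambda>k. h \<otimes> k) H H"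
proof -
  assume h: "h \<in> H"
  have inj: "inj_on (\<lambda>k. h \<otimes> k) H" using h by (auto intro!: inj_onI)
  have "(\<lambda>k. h \<otimes> k) ` H \<subseteq> H" using h by auto
  then have "(\<lambda>k. h \<otimes> k) ` H = H" by (rule endo_inj_surj[OF finite_H _ inj])
  with inj show ?thesis unfolding bij_betw_def by (rule conjI)
qed

text \<open>
  By the cocycle law for \<open>h \<mapsto> \<lambda>\<^sub>h\<close> on \<open>H\<close>, the product \<open>D\<close> of all its values satisfies
  \<open>D = \<lambda>\<^sub>h(D) \<otimes> d(h)\<^sup>m\<close> with \<open>m = card H\<close>. Extracting an \<open>m\<close>-th root of \<open>D\<close> already writes the cocycle as
  a coboundary; a second root is taken so that the correcting term is itself an \<open>m\<close>-th power, which is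
  the amount by which replacing the transversal \<open>H\<close> by \<open>a \<oplus> H\<close> changes a defect.
\<close>

lemma defect_lambda_coboundary:
  "\<exists>a\<in>A. \<forall>h\<in>H. brace_lambda B h a [^] card H \<otimes> inv (a [^] card H) \<otimes> defect (brace_lambda B h) = \<one>"
proof -
  let ?m = "card H" and ?lam = "brace_lambda B"
  let ?d = "\<lambda>h. defect (?lam h)"
  have aff: "affine (?lam h) (?lam h)" if "h \<in> H" for h using affine_lambda H_in_S that by blast
  have d: "?d h \<in> A" if "h \<in> H" for h using defect_closed aff that by blast
  define D where "D = finprod B ?d H"
  have one: "\<one> \<in> H" by simp
  have D: "D \<in> A" unfolding D_def using affine_finprod(1)[OF aff[OF one] finite_H, of ?d] d by auto
  obtain c where c: "c \<in> A" "c [^] ?m = D" using D pow_image by (metis imageE)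
  obtain a where a: "a \<in> A" "a [^] ?m = c" using c pow_image by (metis imageE)
  have "?lam h a [^] ?m \<otimes> inv (a [^] ?m) \<otimes> ?d h = \<one>" if h: "h \<in> H" for h
  proof -
    have cocycle: "?d (h \<otimes> k) = ?lam h (?d k) \<otimes> ?d h" if k: "k \<in> H" for k
    proof -
      have "?d (h \<otimes> k) = defect (?lam h \<circ> ?lam k)"
        using h k H_in_S S_lambda by (intro defect_cong) (simp_all add: lambda_circ)
      then show ?thesis using defect_comp[OF aff[OF h] aff[OF k]] by simp
    qed
    have l: "?lam h (?d k) \<in> A" if "k \<in> H" for k using affineD(3)[OF aff[OF h]] d that by blast
    have "D = finprod B (\<lambda>k. ?d (h \<otimes> k)) H"
      using finprod_reindex[of ?d "\<lambda>k. h \<otimes> k" H] H_translate[OF h] d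
      by (auto simp: bij_betw_def D_def)
    also have "\<dots> = finprod B (\<lambda>k. ?lam h (?d k) \<otimes> ?d h) H"
      using cocycle l d h by (intro finprod_cong') auto
    also have "\<dots> = finprod B (\<lambda>k. ?lam h (?d k)) H \<otimes> finprod B (\<lambda>k. ?d h) H"
      using l d h by (intro finprod_multf) auto
    also have "finprod B (\<lambda>k. ?lam h (?d k)) H = ?lam h D"
      unfolding D_def using affine_finprod(2)[OF aff[OF h] finite_H, of ?d] d by auto
    also have "finprod B (\<lambda>k. ?d h) H = ?d h [^] ?m"
      using d h by (intro finprod_const) auto
    finally have D_eq: "D = ?lam h D \<otimes> ?d h [^] ?m" .
    define X where "X = ?lam h c \<otimes> inv c \<otimes> ?d h"
    have cl: "?lam h c \<in> A" "?lam h D \<in> A" "?d h \<in> A" using affineD(3)[OF aff[OF h]] c D d h by auto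
    have "?lam h c [^] ?m = ?lam h (c [^] ?m)" using affine_pow(2)[OF aff[OF h] c(1)] by simp
    then have "X [^] ?m = ?lam h (c [^] ?m) \<otimes> inv (c [^] ?m) \<otimes> ?d h [^] ?m"
      unfolding X_def using cl c by (simp add: nat_pow_distrib nat_pow_inv)
    also have "\<dots> = (?lam h D \<otimes> ?d h [^] ?m) \<otimes> inv D"
      unfolding c(2) using cl D by (simp add: m_ac)
    also have "\<dots> = \<one>" using D_eq D by simp
    finally have "X = \<one>" using pow_eq_one[of X] cl c unfolding X_def by simp
    then show ?thesis unfolding X_def using a affine_pow(2)[OF aff[OF h], of a ?m] by simp
  qed
  with a show ?thesis by blast
qed

text \<open>
  The corrected defect \<open>\<psi>\<close> is the defect measured against the transversal \<open>a \<oplus> H\<close> in place of \<open>H\<close>.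
  It still obeys the cocycle law, and it vanishes on all \<open>\<lambda>\<^sub>h\<close> with \<open>h \<in> H\<close>.
\<close>

theorem additive_subgroup: "subgroup H (add_monoid B)"
proof -
  let ?m = "card H" and ?lam = "brace_lambda B"
  obtain a where a: "a \<in> A" and
    cob: "\<And>h. h \<in> H \<Longrightarrow> ?lam h a [^] ?m \<otimes> inv (a [^] ?m) \<otimes> defect (?lam h) = \<one>"
    using defect_lambda_coboundary by blast
  define psi where "psi f \<alpha> = \<alpha> a [^] ?m \<otimes> inv (a [^] ?m) \<otimes> defect f" for f \<alpha> :: "'a \<Rightarrow> 'a"
  have psi_comp: "psi (f \<circ> g) (\<alpha> \<circ> \<beta>) = \<alpha> (psi g \<beta>) \<otimes> psi f \<alpha>"
    if f: "affine f \<alpha>" and g: "affine g \<beta>" for f g \<alpha> \<beta>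
  proof -
    note p = affine_pow[OF f] affine_mult[OF f]
    have cl: "\<beta> a \<in> A" "\<alpha> a \<in> A" "\<alpha> (\<beta> a) \<in> A" "defect f \<in> A" "defect g \<in> A" "\<alpha> (defect g) \<in> A"
      using affineD(3)[OF f] affineD(3)[OF g] a defect_closed f g by auto
    have psi_g: "\<alpha> (psi g \<beta>) = \<alpha> (\<beta> a) [^] ?m \<otimes> inv (\<alpha> a [^] ?m) \<otimes> \<alpha> (defect g)"
      unfolding psi_def using cl a pow_A by (simp add: p)
    show ?thesis
      unfolding psi_g unfolding psi_def defect_comp[OF f g] comp_apply
      by (rule cancel_middle[symmetric]) (use cl a in auto)
  qed
  \<comment> \<open>The corrected defect of a translation, whose linear part is conjugation.\<close>
  define kappa where "kappa x = psi (\<lambda>z. x \<oplus> z) (\<lambda>a. x \<oplus> a \<oplus> \<ominus> x)" for x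
  have kappa_add: "kappa (x \<oplus> y) = (x \<oplus> kappa y \<oplus> \<ominus> x) \<otimes> kappa x" if xy: "x \<in> S" "y \<in> S" for x y
  proof -
    have "kappa (x \<oplus> y) = psi ((\<lambda>z. x \<oplus> z) \<circ> (\<lambda>z. y \<oplus> z)) ((\<lambda>a. x \<oplus> a \<oplus> \<ominus> x) \<circ> (\<lambda>a. y \<oplus> a \<oplus> \<ominus> y))"
    proof -
      have "defect (\<lambda>z. x \<oplus> y \<oplus> z) = defect ((\<lambda>z. x \<oplus> z) \<circ> (\<lambda>z. y \<oplus> z))"
        using xy H_in_S by (intro defect_cong) (simp_all add: add.m_assoc)
      moreover have "x \<oplus> y \<oplus> a \<oplus> \<ominus> (x \<oplus> y) = x \<oplus> (y \<oplus> a \<oplus> \<ominus> y) \<oplus> \<ominus> x"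
        using xy a by (simp add: add.m_assoc add.inv_mult_group)
      ultimately show ?thesis unfolding kappa_def psi_def by simp
    qed
    then show ?thesis using psi_comp[OF affine_translation[OF xy(1)] affine_translation[OF xy(2)]]
      unfolding kappa_def by simp
  qed
  have kappa_A: "kappa x \<in> A" if "x \<in> S" for x
    using affineD(3)[OF affine_translation[OF that]] defect_closed[OF affine_translation[OF that]] a pow_A
    unfolding kappa_def psi_def by auto
  have conj_A: "c \<oplus> d \<oplus> \<ominus> c = d" if c: "c \<in> A" and d: "d \<in> A" for c d
  proof -
    have "c \<oplus> d = d \<oplus> c" using trivial[OF c d] trivial[OF d c] m_comm[of c d] c d by simp
    then show ?thesis using c d by (simp add: add.m_assoc)
  qed
  have kappa_of_A: "kappa c = c [^] ?m" if c: "c \<in> A" for c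
  proof -
    have "defect (\<lambda>z. c \<oplus> z) = finprod B (\<lambda>h. c) H"
      unfolding defect_def using c by (intro finprod_cong') auto
    also have "\<dots> = c [^] ?m" using c by (intro finprod_const) auto
    finally show ?thesis unfolding kappa_def psi_def using conj_A[OF c a] a c by simp
  qed
  have kappa_A_add: "kappa (c \<oplus> x) = c [^] ?m \<otimes> kappa x" if c: "c \<in> A" and x: "x \<in> S" for c x
    using kappa_add[OF A_in_S[OF c] x] conj_A[OF c kappa_A[OF x]] kappa_of_A[OF c] c kappa_A[OF x]
    by (simp add: m_comm)
  \<comment> \<open>The translations by elements of \<open>K\<close> fix the class of the transversal \<open>a \<oplus> H\<close>, so \<open>K\<close> is the
    additive complement of \<open>A\<close> that the averaging produces.\<close>
  define K where "K = {x \<in> S. kappa x = \<one>}"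
  have K_add: "x \<oplus> y \<in> K" if "x \<in> K" "y \<in> K" for x y
    using that kappa_add[of x y] unfolding K_def by (simp add: one_eq_zero)
  have kappa_zero: "kappa \<zero> = \<one>"
    using kappa_of_A[of \<zero>] by (simp flip: one_eq_zero)
  have K_neg: "\<ominus> x \<in> K" if "x \<in> K" for x
    using kappa_add[of "\<ominus> x" x] kappa_zero kappa_A[of "\<ominus> x"] that unfolding K_def 
    by (simp add: one_eq_zero)
  have card_K: "card K \<le> ?m"
  proof (rule card_inj_on_le[of complement_part])
    \<comment> \<open>Two elements of \<open>K\<close> in one coset differ by some \<open>c \<in> A\<close> with \<open>c\<^sup>m = \<one>\<close>.\<close>
    show "inj_on complement_part K"
    proof (rule inj_onI)
      fix x y assume "x \<in> K" "y \<in> K" and r: "complement_part x = complement_part y"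
      then have xy: "x \<in> S" "y \<in> S" "kappa x = \<one>" "kappa y = \<one>" unfolding K_def by auto
      let ?c = "ideal_part x \<oplus> \<ominus> ideal_part y"
      have c: "?c \<in> A" using parts xy by simp
      have "?c \<oplus> (ideal_part y \<oplus> complement_part y) = ideal_part x \<oplus> complement_part x"
        using parts(1,2)[OF xy(1)] parts(1)[OF xy(2)] r by (simp add: add.m_assoc)
      then have e: "?c \<oplus> y = x" using parts(3) xy by simp
      then have "?c [^] ?m = \<one>" using kappa_A_add[OF c xy(2)] xy c by simp
      then have "?c = \<zero>" using pow_eq_one[OF c] by (simp add: one_eq_zero)
      with e xy show "x = y" by simp
    qed
    show "complement_part ` K \<subseteq> H" using parts unfolding K_def by auto
  qed (rule finite_H)
  \<comment> \<open>With this \<open>b\<close>, the element \<open>\<lambda>\<^sub>b h\<close> is the translate of \<open>h\<close> by \<open>a - \<mu>(a)\<close>, where \<open>\<mu>\<close> is the linear part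
    of \<open>z \<mapsto> h \<circ> z\<close>; that translation cancels the corrected defect of \<open>h\<close> exactly.\<close>
  define b where "b = \<ominus> a"
  have b: "b \<in> A" unfolding b_def using a by simp
  have lam_K: "?lam b h \<in> K" if h: "h \<in> H" for h
  proof -
    let ?mu = "h \<oplus> ?lam h a \<oplus> \<ominus> h"
    have hS: "h \<in> S" and hc: "h \<in> carrier B" using H_in_S h by auto
    have la: "?lam h a \<in> A" using lambda_A h a by simp
    have mu: "?mu \<in> A" using conj_closed hc la by blast
    have "?lam b h = a \<oplus> (h \<otimes> b)"
      unfolding brace_lambda_def b_def using a hc by (simp add: m_comm)
    also have "h \<otimes> b = h \<oplus> \<ominus> ?lam h a"
      using circ_eq[of h b] lambda_inv[of h a] a hc unfolding b_def by simp
    also have "a \<oplus> (h \<oplus> \<ominus> ?lam h a) = (a \<oplus> \<ominus> ?mu) \<oplus> h"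
      using a hc la by (simp add: add.m_assoc add.inv_mult_group)
    finally have eq: "?lam b h = (a \<oplus> \<ominus> ?mu) \<oplus> h" .
    have aff: "affine (?lam h) (?lam h)" using affine_lambda hS by blast
    \<comment> \<open>This composite is \<open>z \<mapsto> h \<circ> z\<close>, which maps \<open>H\<close> to itself.\<close>
    have "defect ((\<lambda>z. h \<oplus> z) \<circ> ?lam h) = \<one>"
    proof -
      have "defect ((\<lambda>z. h \<oplus> z) \<circ> ?lam h) = finprod B (\<lambda>k. \<one>) H"
        unfolding defect_def using hc h 
        by (intro finprod_cong') (auto simp: circ_eq[symmetric] ideal_part_H)
      then show ?thesis by simp
    qed
    then have "psi ((\<lambda>z. h \<oplus> z) \<circ> ?lam h) ((\<lambda>a. h \<oplus> a \<oplus> \<ominus> h) \<circ> ?lam h)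
       = ?mu [^] ?m \<otimes> inv (a [^] ?m)"
      unfolding psi_def using mu a by simp
    moreover have "psi (?lam h) (?lam h) = \<one>" unfolding psi_def using cob h by blast
    moreover have "h \<oplus> \<one> \<oplus> \<ominus> h = \<one>" using hc by (simp add: one_eq_zero)
    ultimately have k: "kappa h = ?mu [^] ?m \<otimes> inv (a [^] ?m)"
      using psi_comp[OF affine_translation[OF hS] aff] kappa_A[OF hS] hc
      by (simp add: kappa_def)
    have "kappa (?lam b h) = (a \<otimes> inv ?mu) [^] ?m \<otimes> (?mu [^] ?m \<otimes> inv (a [^] ?m))"
      unfolding eq using kappa_A_add[of "a \<oplus> \<ominus> ?mu" h] hS a mu k trivial[of a "inv ?mu"] neg_A[OF mu] by simp
    also have "\<dots> = (a [^] ?m \<otimes> inv (a [^] ?m)) \<otimes> (inv (?mu [^] ?m) \<otimes> ?mu [^] ?m)"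
      using a A.mem_carrier[OF mu] by (simp add: nat_pow_distrib nat_pow_inv m_ac del: l_inv r_inv)
    also have "\<dots> = \<one>" using a A.mem_carrier[OF mu] by simp
    finally show ?thesis unfolding K_def using S_lambda[OF A_in_S[OF b] hS] by simp
  qed
  have bc: "b \<in> carrier B" using b by simp
  have "inj_on (?lam b) H" using lambda_inj[OF bc] by (auto intro!: inj_onI)
  then have "card (?lam b ` H) = ?m" by (rule card_image)
  moreover have "finite K" unfolding K_def using finite_S by simp
  ultimately have K_eq: "?lam b ` H = K" using lam_K card_K by (intro card_seteq) auto
  \<comment> \<open>\<open>K\<close> is the image of \<open>H\<close> under an injective additive map, so its closure properties pull back to \<open>H\<close>.\<close>
  have pull: "x \<in> H" if "x \<in> carrier B" "?lam b x \<in> K" for x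
    using that K_eq lambda_inj[OF bc that(1)] by (metis H.mem_carrier imageE)
  show ?thesis
  proof (rule add.subgroupI)
    show "H \<subseteq> carrier B" by (rule H.subset)
    show "H \<noteq> {}" using H.one_closed by blast
    show "\<ominus> h \<in> H" if "h \<in> H" for h
      using pull[of "\<ominus> h"] lambda_inv[OF bc, of h] K_neg lam_K that by simp
    show "h \<oplus> k \<in> H" if "h \<in> H" "k \<in> H" for h k
      using pull[of "h \<oplus> k"] lambda_add[OF bc, of h k] K_add lam_K that by simp
  qed
qed

end

section \<open>Trivial ideals and a power map into the subgroup\<close>

lemma card_hom_image_dvd:
  assumes "group_hom G F h" "subgroup H G"
  shows "card (h ` H) dvd card H"
proof -
  interpret group_hom "G\<lparr>carrier := H\<rparr>" "F\<lparr>carrier := h ` H\<rparr>" h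
    using group_hom.induced_group_hom assms by blast
  let ?G = "G\<lparr>carrier := H\<rparr>" and ?F = "F\<lparr>carrier := h ` H\<rparr>"
  have "?G Mod kernel ?G ?F h \<cong> ?F"
    using FactGroup_iso_set unfolding is_iso_def by auto
  from iso_same_card[OF this] have "card (rcosets\<^bsub>?G\<^esub> kernel ?G ?F h) = card (h ` H)"
    by (simp add: FactGroup_def)
  moreover have "card (rcosets\<^bsub>?G\<^esub> kernel ?G ?F h) * card (kernel ?G ?F h) = card H"
    using G.lagrange[OF subgroup_kernel] by (simp add: order_def)
  ultimately show ?thesis by (simp add: dvd_def) metis
qed

context comm_skew_brace
begin

lemma pow_card_subgroup:
  assumes H: "subgroup H B" and h: "h \<in> H"
  shows "h [^] card H = \<one>"
proof -
  interpret HG: group "B\<lparr>carrier := H\<rparr>" using subgroup.subgroup_is_group[OF H is_group] .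
  show ?thesis
    using HG.pow_order_eq_1[of h] h nat_pow_consistent[of h "card H" H] by (simp add: order_def)
qed

lemma subgroup_pow_closed: "subgroup K B \<Longrightarrow> x \<in> K \<Longrightarrow> x [^] (n::nat) \<in> K"
  by (induction n) (auto simp: subgroup.one_closed subgroup.m_closed)

text \<open>
  Bezout writes \<open>x\<close> as a product of a power of \<open>x\<^sup>n\<close> and a power of \<open>x\<^sup>k\<close>.
\<close>

lemma coprime_pow_in_subgroup:
  assumes H: "subgroup H B" and x: "x \<in> carrier B" and "x [^] (n::nat) \<in> H" and k: "x [^] (k::nat) = \<one>"
    and "coprime n k" "k \<noteq> 0"
  shows "x \<in> H"
proof -
  obtain u v where uv: "k * u = n * v + 1"
    using bezout_nat[of k n] assms(5,6) by (metis coprime_iff_gcd_eq_1 gcd.commute)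
  have "(x [^] n) [^] v \<otimes> x = (x [^] k) [^] u"
    using x uv by (simp add: nat_pow_pow)
  then have "(x [^] n) [^] v \<otimes> x = \<one>" using k by simp
  then have "x = inv ((x [^] n) [^] v)" using x by (metis inv_equality inv_inv nat_pow_closed)
  moreover have "inv ((x [^] n) [^] v) \<in> H"
    by (intro subgroup.m_inv_closed[OF H] subgroup_pow_closed[OF H] assms(3))
  ultimately show ?thesis by metis
qed

lemma hom_pow_on_trivial_ideal:
  assumes K: "subgroup A B" and \<phi>: "\<And>a. a \<in> A \<Longrightarrow> \<phi> a \<in> A"
    and mult: "\<And>a b. \<lbrakk>a \<in> A; b \<in> A\<rbrakk> \<Longrightarrow> \<phi> (a \<otimes> b) = \<phi> a \<otimes> \<phi> b" and a: "a \<in> A"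
  shows "\<phi> (a [^] (n::nat)) = \<phi> a [^] n"
proof -
  have c: "\<phi> b \<in> carrier B" if "b \<in> A" for b using \<phi>[OF that] subgroup.mem_carrier[OF K] by blast
  have one: "\<one> \<in> A" using subgroup.one_closed[OF K] .
  have "\<phi> \<one> \<otimes> \<phi> \<one> = \<phi> \<one>" using mult[OF one one] by simp
  then have "\<phi> \<one> = \<one>" using c[OF one] by simp
  then show ?thesis
    by (induction n) (use mult subgroup_pow_closed[OF K] a in auto)
qed

lemma additive_subgroup_trivial:
  assumes A: "brace_ideal A B" and triv: "\<And>a b. \<lbrakk>a \<in> A; b \<in> A\<rbrakk> \<Longrightarrow> a \<otimes> b = a \<oplus> b"
    and K: "subgroup K B" "K \<subseteq> A"
  shows "subgroup K (add_monoid B)"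
proof (rule add.subgroupI)
  show "K \<subseteq> carrier B" using K(1) by (rule subgroup.subset)
  show "K \<noteq> {}" using subgroup.one_closed[OF K(1)] by blast
  show "a \<oplus> b \<in> K" if "a \<in> K" "b \<in> K" for a b
    using subgroup.m_closed[OF K(1) that] triv[of a b] that K(2) subsetD by metis
  show "\<ominus> a \<in> K" if a: "a \<in> K" for a
  proof -
    have i: "inv a \<in> K" using subgroup.m_inv_closed[OF K(1) a] .
    have c: "a \<in> carrier B" "inv a \<in> carrier B" using subgroup.mem_carrier[OF K(1)] a i by auto
    have "inv a \<oplus> a = inv a \<otimes> a" using triv[of "inv a" a] subsetD[OF K(2)] a i by simp
    then have "inv a \<oplus> a = \<zero>" using c by (simp add: one_eq_zero)
    then have "\<ominus> a = inv a" using add.inv_equality[of "inv a" a] c by simp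
    then show ?thesis using i by simp
  qed
qed

text \<open>
  On a trivial ideal the powers are multiples for both operations, and so they are respected by
  additive conjugation and by every \<open>\<lambda>\<^sub>x\<close>.
\<close>

lemma power_ideal:
  assumes A: "brace_ideal A B" and triv: "\<And>a b. \<lbrakk>a \<in> A; b \<in> A\<rbrakk> \<Longrightarrow> a \<otimes> b = a \<oplus> b"
  shows "brace_ideal ((\<lambda>a. a [^] (n::nat)) ` A) B"
proof -
  let ?P = "(\<lambda>a. a [^] n) ` A"
  have N: "A \<lhd> add_monoid B" and sub: "subgroup A B"
    using A normal_imp_subgroup by (auto simp: brace_ideal_def)
  have P_A: "?P \<subseteq> A" using subgroup_pow_closed[OF sub] by auto
  have c: "a \<in> carrier B" if "a \<in> A" for a using subgroup.mem_carrier[OF sub that] .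
  have P: "subgroup ?P B"
  proof (rule subgroupI)
    show "?P \<subseteq> carrier B" using c by auto
    show "?P \<noteq> {}" using subgroup.one_closed[OF sub] by auto
    show "inv x \<in> ?P" if "x \<in> ?P" for x
    proof -
      from that obtain a where "a \<in> A" "x = a [^] n" by auto
      then have "inv a \<in> A" "inv x = inv a [^] n" using c subgroup.m_inv_closed[OF sub] by (auto simp: nat_pow_inv)
      then show ?thesis by (rule rev_image_eqI)
    qed
    show "x \<otimes> y \<in> ?P" if "x \<in> ?P" "y \<in> ?P" for x y
    proof -
      from that obtain a b where "a \<in> A" "b \<in> A" "x = a [^] n" "y = b [^] n" by auto
      then have "a \<otimes> b \<in> A" "x \<otimes> y = (a \<otimes> b) [^] n"
        using c subgroup.m_closed[OF sub] by (auto simp: nat_pow_distrib)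
      then show ?thesis by (rule rev_image_eqI)
    qed
  qed
  have stable: "\<phi> x \<in> ?P" if "x \<in> ?P" and \<phi>: "\<And>a. a \<in> A \<Longrightarrow> \<phi> a \<in> A"
    and add: "\<And>a b. \<lbrakk>a \<in> A; b \<in> A\<rbrakk> \<Longrightarrow> \<phi> (a \<oplus> b) = \<phi> a \<oplus> \<phi> b" for \<phi> x
  proof -
    from that(1) obtain a where a: "a \<in> A" "x = a [^] n" by auto
    have "\<phi> x = \<phi> a [^] n" unfolding a(2)
      using hom_pow_on_trivial_ideal[OF sub, of \<phi> a n] \<phi> add a(1) triv by simp
    then show ?thesis using \<phi>[OF a(1)] by (rule rev_image_eqI[rotated])
  qed
  have "?P \<lhd> add_monoid B"
  proof -
    have "x \<oplus> y \<oplus> \<ominus> x \<in> ?P" if x: "x \<in> carrier B" and y: "y \<in> ?P" for x y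
    proof (rule stable[OF y])
      show "x \<oplus> a \<oplus> \<ominus> x \<in> A" if "a \<in> A" for a
        using add.normal_inv_iff[of A] N x that by (simp add: a_inv_def[symmetric])
      show "x \<oplus> (a \<oplus> b) \<oplus> \<ominus> x = x \<oplus> a \<oplus> \<ominus> x \<oplus> (x \<oplus> b \<oplus> \<ominus> x)" if "a \<in> A" "b \<in> A" for a b
        using c[OF that(1)] c[OF that(2)] x by (simp add: add.m_assoc)
    qed
    then show ?thesis using additive_subgroup_trivial[OF A triv P P_A] add.normal_inv_iff[of ?P]
      by (simp add: a_inv_def[symmetric])
  qed
  moreover have "?P \<lhd> B" using subgroup_imp_normal P by blast
  moreover have "brace_lambda B x ` ?P \<subseteq> ?P" if x: "x \<in> carrier B" for x
  proof (rule image_subsetI)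
    fix y assume y: "y \<in> ?P"
    show "brace_lambda B x y \<in> ?P"
    proof (rule stable[OF y])
      show "brace_lambda B x a \<in> A" if "a \<in> A" for a
        using A x that unfolding brace_ideal_def by blast
    qed (use x c lambda_add in simp)
  qed
  ultimately show ?thesis unfolding brace_ideal_def by blast
qed

text \<open>
  An \<open>a \<in> A\<close> killed by a power of \<open>m = card H\<close> has order coprime to \<open>N\<close>, so it lies in \<open>H\<close> together with
  \<open>a\<^sup>N\<close>, and then \<open>a\<^sup>m = \<one>\<close>. Hence the \<open>m\<close>-th power map is injective on the ideal \<open>P\<close> of \<open>m\<close>-th powers, and
  \<open>A\<close> is the product of \<open>P\<close> with a part inside \<open>H\<close>. The averaging argument then applies to \<open>P\<close>.
\<close>

lemma additive_subgroup_of_coprime_exponent: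
  assumes fin: "finite (carrier B)" and A: "brace_ideal A B"
    and triv: "\<And>a b. \<lbrakk>a \<in> A; b \<in> A\<rbrakk> \<Longrightarrow> a \<otimes> b = a \<oplus> b"
    and H: "subgroup H B" and N: "coprime N (card H)" "\<And>x. x \<in> A \<Longrightarrow> x [^] (N::nat) \<in> H"
    and S: "subgroup (H <#> A) (add_monoid B)"
  shows "subgroup H (add_monoid B)"
proof -
  let ?m = "card H"
  let ?P = "(\<lambda>a. a [^] ?m) ` A"
  have sub: "subgroup A B" using A normal_imp_subgroup by (auto simp: brace_ideal_def)
  note A_pow = subgroup_pow_closed[OF sub]
  have c: "a \<in> carrier B" if "a \<in> A" for a using subgroup.mem_carrier[OF sub that] .
  have m: "?m \<noteq> 0"
    using subgroup.finite_imp_card_positive[OF H] fin by simp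
  have tors: "a [^] ?m = \<one>" if a: "a \<in> A" "(a [^] ?m) [^] ?m = \<one>" for a
  proof -
    have "a [^] (?m * ?m) = \<one>" using a c by (simp add: nat_pow_pow)
    then have "a \<in> H"
      using coprime_pow_in_subgroup[OF H c[OF a(1)] N(2)[OF a(1)], of "?m * ?m"] N(1) m by simp
    then show ?thesis by (rule pow_card_subgroup[OF H])
  qed
  have quot: "(a \<otimes> inv b) [^] (n::nat) = a [^] n \<otimes> inv (b [^] n)" if "a \<in> A" "b \<in> A" for a b n
    using c[OF that(1)] c[OF that(2)] by (simp add: nat_pow_distrib nat_pow_inv)
  have ab: "a \<otimes> inv b \<in> A" if "a \<in> A" "b \<in> A" for a b
    using that subgroup.m_closed[OF sub] subgroup.m_inv_closed[OF sub] by blast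
  have inj: "inj_on (\<lambda>a. a [^] ?m) ?P"
  proof (rule inj_onI)
    fix x y assume "x \<in> ?P" "y \<in> ?P" and eq: "x [^] ?m = y [^] ?m"
    then obtain a b where a: "a \<in> A" "x = a [^] ?m" and b: "b \<in> A" "y = b [^] ?m" by auto
    have "((a \<otimes> inv b) [^] ?m) [^] ?m = (x \<otimes> inv y) [^] ?m"
      unfolding a(2) b(2) quot[OF a(1) b(1)] ..
    also have "\<dots> = x [^] ?m \<otimes> inv (y [^] ?m)" using a b A_pow by (intro quot) auto
    also have "\<dots> = \<one>" unfolding eq using b c by simp
    finally have "(a \<otimes> inv b) [^] ?m = \<one>" by (rule tors[OF ab[OF a(1) b(1)]])
    then have one: "x \<otimes> inv y = \<one>" using quot[OF a(1) b(1), of ?m] unfolding a(2) b(2) by simp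
    have xy: "x \<in> carrier B" "y \<in> carrier B" using a b c by auto
    then have "x = (x \<otimes> inv y) \<otimes> y" by (simp add: m_assoc)
    also have "\<dots> = y" unfolding one using xy by simp
    finally show "x = y" .
  qed
  have P_A: "?P \<subseteq> A" using A_pow by auto
  have "finite A" using fin subgroup.subset[OF sub] finite_subset by blast
  then have "finite ?P" by simp
  then have surj: "(\<lambda>a. a [^] ?m) ` ?P = ?P"
    by (rule endo_inj_surj[OF _ _ inj]) (use P_A in auto)
  have S_eq: "H <#> ?P = H <#> A"
  proof
    show "H <#> ?P \<subseteq> H <#> A" using P_A unfolding set_mult_def by blast
    show "H <#> A \<subseteq> H <#> ?P"
    proof
      fix x assume "x \<in> H <#> A"
      then obtain h a where h: "h \<in> H" and a: "a \<in> A" and x: "x = h \<otimes> a"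
        unfolding set_mult_def by auto
      have "a [^] ?m \<in> (\<lambda>a. a [^] ?m) ` ?P" unfolding surj using a by (rule imageI)
      then obtain b where b: "b \<in> ?P" "a [^] ?m = b [^] ?m" by (rule imageE)
      then have bA: "b \<in> A" using P_A by blast
      have p1: "(a \<otimes> inv b) [^] ?m = \<one>" unfolding quot[OF a bA] b(2) using c[OF bA] by simp
      have "a \<otimes> inv b \<in> H"
        using coprime_pow_in_subgroup[OF H c[OF ab[OF a bA]] N(2)[OF ab[OF a bA]] p1 N(1) m] .
      then have "h \<otimes> (a \<otimes> inv b) \<in> H" using h subgroup.m_closed[OF H] by blast
      moreover have "x = (h \<otimes> (a \<otimes> inv b)) \<otimes> b"
        unfolding x using subgroup.mem_carrier[OF H h] c[OF a] c[OF bA] by (simp add: m_assoc)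
      ultimately show "x \<in> H <#> ?P" using b(1) unfolding set_mult_def by blast
    qed
  qed
  have "coprime_trivial_ideal B ?P H"
  proof (intro coprime_trivial_ideal.intro coprime_trivial_ideal_axioms.intro)
    show "comm_skew_brace B" by (rule comm_skew_brace_axioms)
    show "brace_ideal ?P B" using A triv by (rule power_ideal)
    show "a \<otimes> b = a \<oplus> b" if "a \<in> ?P" "b \<in> ?P" for a b
      using triv subsetD[OF P_A] that by simp
    show "subgroup (H <#> ?P) (add_monoid B)" unfolding S_eq by (rule S)
  qed (rule fin H inj)+
  then show ?thesis by (rule coprime_trivial_ideal.additive_subgroup)
qed

section \<open>Descent along the chain of ideals\<close>

lemma comm_skew_brace_quot:
  assumes I: "brace_ideal I B"
  shows "comm_skew_brace (B Quot I)"
proof -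
  interpret Q: skew_brace "B Quot I" using I by (rule skew_brace_quot)
  have "comm_group (B Quot I)"
    by (rule group.group_comm_groupI[OF Q.circ_group]) (auto simp: carrier_quot quot_circ[OF I] m_comm)
  then show ?thesis
    by (intro comm_skew_brace.intro comm_skew_brace_axioms.intro Q.skew_brace_axioms)
qed

lemma quot_hom_circ:
  assumes I: "brace_ideal I B"
  shows "group_hom B (B Quot I) (\<lambda>a. I +> a)"
  using is_group skew_brace.circ_group[OF skew_brace_quot[OF I]]
  by (auto simp: group_hom_def group_hom_axioms_def hom_def carrier_quot quot_circ[OF I])

lemma quot_hom_add:
  assumes I: "brace_ideal I B"
  shows "group_hom (add_monoid B) (add_monoid (B Quot I)) (\<lambda>a. I +> a)"
  using add.is_group skew_brace.add_group[OF skew_brace_quot[OF I]]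
  by (auto simp: group_hom_def group_hom_axioms_def hom_def carrier_quot quot_add[OF I])

lemma quot_lambda:
  assumes I: "brace_ideal I B" and ab: "a \<in> carrier B" "b \<in> carrier B"
  shows "brace_lambda (B Quot I) (I +> a) (I +> b) = I +> brace_lambda B a b"
proof -
  have "\<ominus>\<^bsub>B Quot I\<^esub> (I +> a) = I +> (\<ominus> a)"
    using group_hom.hom_inv[OF quot_hom_add[OF I], of a] ab by (simp add: a_inv_def)
  then show ?thesis
    unfolding brace_lambda_def using ab by (simp add: quot_circ[OF I] quot_add[OF I])
qed

lemma quot_image_ideal:
  assumes I: "brace_ideal I B" and J: "brace_ideal J B"
  shows "brace_ideal ((\<lambda>a. I +> a) ` J) (B Quot I)"
  unfolding brace_ideal_def
proof (intro conjI ballI image_subsetI)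
  have N: "J \<lhd> add_monoid B" "J \<lhd> B" using J by (auto simp: brace_ideal_def)
  show "(\<lambda>a. I +> a) ` J \<lhd> add_monoid (B Quot I)"
    by (rule normal.surj_hom_normal_subgroup[OF N(1) quot_hom_add[OF I]]) (simp add: carrier_quot)
  show "(\<lambda>a. I +> a) ` J \<lhd> B Quot I"
    by (rule normal.surj_hom_normal_subgroup[OF N(2) quot_hom_circ[OF I]]) (simp add: carrier_quot)
  fix x y assume "x \<in> carrier (B Quot I)" "y \<in> (\<lambda>a. I +> a) ` J"
  then obtain a b where a: "a \<in> carrier B" "x = I +> a" and b: "b \<in> J" "y = I +> b"
    by (auto simp: carrier_quot)
  have "brace_lambda B a b \<in> J" using J a(1) b(1) unfolding brace_ideal_def by blast
  then show "brace_lambda (B Quot I) x y \<in> (\<lambda>a. I +> a) ` J"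
    unfolding a(2) b(2) quot_lambda[OF I a(1) ideal_carrier[OF J b(1)]] by (rule imageI)
qed

text \<open>
  The quotient of the restricted brace has the same operations as the full quotient, so triviality of
  the section is a statement about the image of \<open>J\<close> in \<open>B Quot I\<close>.
\<close>

lemma trivial_section:
  assumes "trivial_abelian_skew_brace ((B\<lparr>carrier := J\<rparr>) Quot I)"
    and "x \<in> (\<lambda>a. I +> a) ` J" "y \<in> (\<lambda>a. I +> a) ` J"
  shows "x \<otimes>\<^bsub>B Quot I\<^esub> y = x \<oplus>\<^bsub>B Quot I\<^esub> y"
proof -
  let ?R = "(B\<lparr>carrier := J\<rparr>) Quot I"
  have "carrier ?R = (\<lambda>a. I +> a) ` J"
    by (auto simp: FactRing_def A_RCOSETS_def RCOSETS_def a_r_coset_def r_coset_def)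
  then have "x \<otimes>\<^bsub>?R\<^esub> y = x \<oplus>\<^bsub>?R\<^esub> y"
    using trivial_abelian_skew_brace.ops_coincide[OF assms(1)] assms(2,3) by simp
  then show ?thesis
    by (simp add: FactRing_def rcoset_mult_def a_r_coset_def r_coset_def set_add_def set_mult_def)
qed

text \<open>
  In the quotient by \<open>I\<close> the image of \<open>J\<close> is a trivial ideal, and the image of \<open>H\<close> inherits both its
  exponent condition and, since its order divides \<open>card H\<close>, the coprimality. It is therefore an
  additive subgroup, and \<open>H <#> I\<close> is its preimage.
\<close>

lemma additive_subgroup_descend:
  assumes fin: "finite (carrier B)" and I: "brace_ideal I B" and J: "brace_ideal J B"
    and triv: "trivial_abelian_skew_brace ((B\<lparr>carrier := J\<rparr>) Quot I)"
    and H: "subgroup H B"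
    and N: "coprime N (card H)" "\<And>x. x \<in> carrier B \<Longrightarrow> x [^] (N::nat) \<in> H"
    and S: "subgroup (H <#> J) (add_monoid B)"
  shows "subgroup (H <#> I) (add_monoid B)"
proof -
  let ?Q = "B Quot I" and ?q = "\<lambda>a. I +> a"
  interpret Q: comm_skew_brace ?Q using I by (rule comm_skew_brace_quot)
  interpret q: group_hom B ?Q ?q using I by (rule quot_hom_circ)
  note Hc = subgroup.mem_carrier[OF H]
  have Isub: "subgroup I B" using I normal_imp_subgroup by (auto simp: brace_ideal_def)
  have qH: "subgroup (?q ` H) (add_monoid ?Q)"
  proof (rule Q.additive_subgroup_of_coprime_exponent)
    show "finite (carrier ?Q)" using fin by (simp add: carrier_quot)
    show "brace_ideal (?q ` J) ?Q" using I J by (rule quot_image_ideal)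
    show "x \<otimes>\<^bsub>?Q\<^esub> y = x \<oplus>\<^bsub>?Q\<^esub> y" if "x \<in> ?q ` J" "y \<in> ?q ` J" for x y
      using triv that by (rule trivial_section)
    show "subgroup (?q ` H) ?Q" using H by (rule q.subgroup_img_is_subgroup)
    show "coprime N (card (?q ` H))"
      using N(1) card_hom_image_dvd[OF q.group_hom_axioms H] coprime_divisors[OF dvd_refl] by blast
    show "x [^]\<^bsub>?Q\<^esub> N \<in> ?q ` H" if x: "x \<in> ?q ` J" for x
    proof -
      obtain a where a: "a \<in> J" "x = ?q a" using x by auto
      have ac: "a \<in> carrier B" using J a(1) by (rule ideal_carrier)
      have "x [^]\<^bsub>?Q\<^esub> N = ?q (a [^] N)" unfolding a(2) using q.hom_nat_pow[OF ac] by simp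
      then show ?thesis using N(2)[OF ac] by (rule image_eqI)
    qed
    have "?q ` H <#>\<^bsub>?Q\<^esub> ?q ` J = ?q ` (H <#> J)"
      unfolding set_mult_def using quot_circ[OF I Hc ideal_carrier[OF J]] by (simp add: image_UN)
    then show "subgroup (?q ` H <#>\<^bsub>?Q\<^esub> ?q ` J) (add_monoid ?Q)"
      using group_hom.subgroup_img_is_subgroup[OF quot_hom_add[OF I] S] by simp
  qed
  have mem: "x \<in> H <#> I \<longleftrightarrow> x \<in> carrier B \<and> ?q x \<in> ?q ` H" for x
  proof
    assume "x \<in> H <#> I"
    then obtain h i where h: "h \<in> H" and i: "i \<in> I" and x: "x = h \<otimes> i"
      unfolding set_mult_def by auto
    have c: "h \<in> carrier B" "i \<in> carrier B" using Hc h ideal_carrier[OF I i] by auto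
    then have "x \<in> I #> h" unfolding r_coset_def x using i m_comm by blast
    then have "?q h = ?q x"
      using repr_independence[OF _ c(1) Isub, of x] ideal_cosets_agree[OF I] c x by simp
    then show "x \<in> carrier B \<and> ?q x \<in> ?q ` H" using h c x by (simp add: image_iff) metis
  next
    assume "x \<in> carrier B \<and> ?q x \<in> ?q ` H"
    then obtain h where x: "x \<in> carrier B" and h: "h \<in> H" "?q x = ?q h" by auto
    have "x \<in> I #> h"
      using rcos_self[OF x Isub] ideal_cosets_agree[OF I x] ideal_cosets_agree[OF I Hc[OF h(1)]] h(2) by simp
    then obtain i where i: "i \<in> I" "x = i \<otimes> h" unfolding r_coset_def by auto
    then have "x = h \<otimes> i" using m_comm Hc[OF h(1)] ideal_carrier[OF I i(1)] by simp
    then show "x \<in> H <#> I" unfolding set_mult_def using h(1) i(1) by blast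
  qed
  interpret qa: group_hom "add_monoid B" "add_monoid ?Q" ?q using I by (rule quot_hom_add)
  show ?thesis
  proof (rule add.subgroupI)
    show "H <#> I \<subseteq> carrier B" using mem by blast
    show "H <#> I \<noteq> {}" using subgroup.one_closed[OF H] subgroup.one_closed[OF Isub]
      unfolding set_mult_def by blast
    fix x assume x: "x \<in> H <#> I"
    have "?q (\<ominus> x) = inv\<^bsub>add_monoid ?Q\<^esub> (?q x)"
      using qa.hom_inv[of x] x mem by (simp add: a_inv_def)
    then show "\<ominus> x \<in> H <#> I"
      using subgroup.m_inv_closed[OF qH, of "?q x"] x mem by simp
    fix y assume y: "y \<in> H <#> I"
    show "x \<oplus> y \<in> H <#> I"
      using subgroup.m_closed[OF qH, of "?q x" "?q y"] x y mem quot_add[OF I, of x y] by simp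
  qed
qed

section \<open>Hall subgroups of soluble skew braces\<close>

lemma index_pow_in_subgroup:
  assumes H: "subgroup H B" and x: "x \<in> carrier B"
  shows "x [^] card (rcosets H) \<in> H"
proof -
  interpret N: normal H B using subgroup_imp_normal[OF H] .
  interpret F: group "B Mod H" by (rule N.factorgroup_is_group)
  interpret r: group_hom B "B Mod H" "\<lambda>a. H #> a"
    using N.r_coset_hom_Mod is_group F.is_group by (simp add: group_hom_def group_hom_axioms_def)
  have "H #> (x [^] card (rcosets H)) = (H #> x) [^]\<^bsub>B Mod H\<^esub> order (B Mod H)"
    using r.hom_nat_pow[OF x, of "order (B Mod H)"] by (simp add: order_def FactGroup_def)
  also have "\<dots> = H"
    using F.pow_order_eq_1[OF r.hom_closed[OF x]] by (simp add: FactGroup_def)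
  finally show ?thesis using rcos_self[OF nat_pow_closed[OF x] H] by blast
qed

text \<open>
  Induction down the chain of ideals: \<open>H <#> I j\<close> is all of \<open>B\<close> at the top and \<open>H\<close> at the bottom.
\<close>

theorem soluble_hall_additive_subgroup:
  assumes fin: "finite (carrier B)" and sol: "soluble_skew_brace B"
    and H: "subgroup H B" and cop: "coprime (card (rcosets H)) (card H)"
  shows "subgroup H (add_monoid B)"
proof -
  obtain n and I :: "nat \<Rightarrow> 'a set" where I0: "I 0 = {\<zero>}" and In: "I n = carrier B"
    and ideal: "\<And>j. j \<le> n \<Longrightarrow> brace_ideal (I j) B"
    and sec: "\<And>j. j < n \<Longrightarrow> trivial_abelian_skew_brace ((B\<lparr>carrier := I (Suc j)\<rparr>) Quot I j)"
    using sol unfolding soluble_skew_brace_def by auto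
  have "subgroup (H <#> I j) (add_monoid B)" if "j \<le> n" for j
    using that
  proof (induction j rule: inc_induct)
    case base
    have "H <#> carrier B = carrier B"
    proof (intro equalityI subsetI)
      fix x assume "x \<in> carrier B"
      then have "x = \<one> \<otimes> x" "x \<in> carrier B" by simp_all
      then show "x \<in> H <#> carrier B"
        using subgroup.one_closed[OF H] unfolding set_mult_def by blast
    qed (use subgroup.mem_carrier[OF H] in \<open>auto simp: set_mult_def\<close>)
    then show ?case using add.subgroup_self unfolding In by simp
  next
    case (step j)
    then show ?case
      using additive_subgroup_descend[OF fin ideal ideal sec H cop index_pow_in_subgroup[OF H]]
      by simp
  qed
  from this[of 0] have "subgroup (H <#> {\<one>}) (add_monoid B)" by (simp add: I0 one_eq_zero)
  moreover have "H <#> {\<one>} = H"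
    using subgroup.mem_carrier[OF H] by (auto simp: set_mult_def)
  ultimately show ?thesis by simp
qed

end

text \<open>
  A common prime divisor \<open>p\<close> would lie in \<open>\<pi>\<close>, and multiplying by \<open>p\<close> would give a larger \<open>\<pi>\<close>-divisor.
\<close>

lemma coprime_largest_pi_divisor:
  assumes n: "n > 0"
  shows "coprime (n div largest_pi_divisor \<pi> n) (largest_pi_divisor \<pi> n)"
proof (rule ccontr)
  let ?S = "{d. d dvd n \<and> pi_number \<pi> d}" and ?M = "largest_pi_divisor \<pi> n"
  have fin: "finite ?S" using n by simp
  have "1 \<in> ?S" by (simp add: pi_number_def)
  then have M: "?M \<in> ?S" unfolding largest_pi_divisor_def using Max_in[OF fin] by blast
  assume "\<not> coprime (n div ?M) ?M"
  then obtain c where c: "c dvd n div ?M" "c dvd ?M" "\<not> is_unit c" by (rule not_coprimeE)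
  then obtain p where "prime p" "p dvd c" using prime_factor_nat[of c] by auto
  with c have p: "prime p" "p dvd n div ?M" "p dvd ?M" using dvd_trans by blast+
  have "?M * p dvd n" using M p(2) by (metis dvd_mult_div_cancel mem_Collect_eq mult_dvd_mono dvd_refl)
  moreover have "pi_number \<pi> (?M * p)"
    using M p prime_gt_0_nat[OF p(1)] unfolding pi_number_def
    by (auto simp: prime_dvd_mult_iff primes_dvd_imp_eq)
  ultimately have "?M * p \<le> ?M" unfolding largest_pi_divisor_def using Max_ge[OF fin] by blast
  moreover have "?M > 0" using M by (simp add: pi_number_def)
  ultimately show False using prime_gt_1_nat[OF p(1)] by simp
qed

theorem corollary15:
  fixes B :: "('a, 'b) ring_scheme" and \<pi> :: "nat set" and H :: "'a set"
  assumes "\<forall>p\<in>\<pi>. prime p"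
    and "skew_brace B"
    and "finite (carrier B)"
    and "soluble_skew_brace B"
    and "comm_group B"
  shows "hall_sub_skew_brace \<pi> H B \<longleftrightarrow> hall_subgroup \<pi> H B"
proof
  assume "hall_sub_skew_brace \<pi> H B"
  then show "hall_subgroup \<pi> H B"
    by (simp add: hall_sub_skew_brace_def sub_skew_brace_def hall_subgroup_def)
next
  interpret comm_skew_brace B
    using assms by (intro comm_skew_brace.intro comm_skew_brace_axioms.intro)
  assume "hall_subgroup \<pi> H B"
  then have H: "subgroup H B" and card: "card H = largest_pi_divisor \<pi> (order B)"
    by (simp_all add: hall_subgroup_def)
  have pos: "order B > 0" using assms(3) order_gt_0_iff_finite by blast
  have "card (rcosets\<^bsub>B\<^esub> H) * card H = order B" using lagrange[OF H] .
  then have "card (rcosets\<^bsub>B\<^esub> H) = order B div card H" using pos by (metis div_mult_self_is_m gr0I mult_0_right less_irrefl)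
  then have "coprime (card (rcosets\<^bsub>B\<^esub> H)) (card H)"
    using coprime_largest_pi_divisor[OF pos] card by simp
  then have "subgroup H (add_monoid B)"
    using soluble_hall_additive_subgroup[OF assms(3,4) H] by blast
  then show "hall_sub_skew_brace \<pi> H B"
    using H card by (simp add: hall_sub_skew_brace_def sub_skew_brace_def)
qed

end
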